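(* For $n\ge 0$ let \[ a_n:= \sum_{k=0}^n\binom{n}{\lfloor k/2\rfloor}(-2)^{n-k}. \] Then for every integer $n\ge 3$, \[ 2na_n+(5n-4)a_{n-1}-(8n-6)a_{n-2}-20(n-2)a_{n-3}=0. \] *)

theory Defs
  imports Complex_Main
begin

definition a :: "nat \<Rightarrow> int" where
  "a n = (\<Sum>k=0..n. int (n choose (k div 2)) * (-2) ^ (n - k))"

end

theory Submission
  imports Defs
begin

text \<open>
  Write \<open>M n\<close> for the middle binomial coefficient \<open>n choose (n div 2)\<close>.  Applying Pascal's rule to
  every summand of \<open>a (n + 1)\<close> yields two copies of the sum \<open>a n\<close>, scaled by \<open>-2\<close> and \<open>-1/2\<close>, up to
  boundary terms that are all multiples of \<open>M n\<close>.  Hence \<open>a\<close> satisfies the first-order recurrence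
  \<open>2 * a (n + 1) + 5 * a n = 3 * M n\<close> (lemma \<open>a_Suc\<close>).  The middle binomial coefficients in turn
  satisfy \<open>(n + 3) * M (n + 2) = 2 * M (n + 1) + 4 * (n + 1) * M n\<close> (lemma
  \<open>middle_binomial_recurrence\<close>), and substituting the former recurrence into the latter eliminates
  \<open>M\<close> and leaves the four-term recurrence for \<open>a\<close>.
\<close>

lemma middle_binomial_even:
  "(2 * m + 2) choose (m + 1) = 2 * ((2 * m + 1) choose m)"
proof -
  have "(2 * m + 1) choose (m + 1) = (2 * m + 1) choose m"
    using binomial_symmetric[of m "2 * m + 1"] by simp
  then show ?thesis by simp
qed

lemma middle_binomial_odd:
  "(m + 1) * ((2 * m + 1) choose m) = (2 * m + 1) * ((2 * m) choose m)"
  using Suc_times_binomial_add[of m m] binomial_symmetric[of m "2 * m + 1"]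
    Suc_times_binomial_eq[of "2 * m" m]
  by (simp add: mult_2)

lemma middle_binomial_recurrence:
  "(n + 3) * ((n + 2) choose ((n + 2) div 2))
     = 2 * ((n + 1) choose ((n + 1) div 2)) + 4 * (n + 1) * (n choose (n div 2))"
proof (cases "even n")
  case True
  then obtain m where n: "n = 2 * m" by blast
  define x y where "x = (2 * m) choose m" and "y = (2 * m + 1) choose m"
  have "(m + 1) * y = (2 * m + 1) * x"
    using middle_binomial_odd[of m] by (simp only: x_def y_def)
  then have "(n + 3) * (2 * y) = 2 * y + 4 * (n + 1) * x"
    by (simp add: n algebra_simps)
  moreover have "(n + 2) choose ((n + 2) div 2) = 2 * y"
    using middle_binomial_even[of m] by (simp add: n y_def del: binomial_Suc_Suc)
  moreover have "(n + 1) choose ((n + 1) div 2) = y" "n choose (n div 2) = x"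
    by (simp_all add: n x_def y_def)
  ultimately show ?thesis by (simp only:)
next
  case False
  then obtain m where n: "n = 2 * m + 1" using oddE by blast
  define y z w
    where "y = (2 * m + 1) choose m" and "z = (2 * m + 2) choose (m + 1)"
      and "w = (2 * m + 3) choose (m + 1)"
  have "z = 2 * y"
    using middle_binomial_even[of m] by (simp only: y_def z_def)
  moreover have "(m + 2) * w = (2 * m + 3) * z"
  proof -
    have "m + 1 + 1 = m + 2" "2 * (m + 1) + 1 = 2 * m + 3" "2 * (m + 1) = 2 * m + 2"
      by simp_all
    then show ?thesis
      using middle_binomial_odd[of "m + 1"] by (simp only: z_def w_def)
  qed
  ultimately have "(n + 3) * w = 2 * z + 4 * (n + 1) * y"
    by (simp add: n algebra_simps)
  moreover have "n + 2 = 2 * m + 3" "n + 1 = 2 * m + 2" "n div 2 = m"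
    "(n + 1) div 2 = m + 1" "(n + 2) div 2 = m + 1"
    by (simp_all add: n)
  then have "(n + 2) choose ((n + 2) div 2) = w" "(n + 1) choose ((n + 1) div 2) = z"
    "n choose (n div 2) = y"
    unfolding y_def z_def w_def using n by metis+
  ultimately show ?thesis by (simp only:)
qed

lemma middle_binomial_round_up:
  "n choose ((n + 1) div 2) = n choose (n div 2)"
proof -
  have "n - n div 2 = (n + 1) div 2" by presburger
  then show ?thesis using binomial_symmetric[of "n div 2" n] by simp
qed

text \<open>
  Lowering \<open>k div 2\<close> by one in Pascal's rule means lowering \<open>k\<close> by two, which accounts for the
  factor \<open>-1/2\<close>; both sides are doubled to stay within the integers.
\<close>

lemma a_Suc:
  "2 * a (Suc n) + 5 * a n = 3 * int (n choose (n div 2))"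
proof -
  define M where "M = int (n choose (n div 2))"
  define f where "f k = int (n choose (k div 2)) * (-2) ^ (n - k)" for k
  define T where "T = (\<Sum>k<n. f k)"
  have a_n: "a n = T + M"
    by (simp add: a_def T_def f_def M_def atLeast0AtMost flip: lessThan_Suc_atMost)
  define g where "g k = int (Suc n choose (k div 2)) * (-2) ^ (Suc n - k)" for k
  define p where "p k = int (n choose (k div 2)) * (-2) ^ (Suc n - k)" for k
  have pascal: "2 * g (Suc (Suc k)) = 2 * p (Suc (Suc k)) - f k" if "k < n" for k
  proof -
    have "n - k = Suc (n - Suc k)" using that by simp
    then show ?thesis by (simp add: g_def p_def f_def algebra_simps)
  qed
  have p_f: "p k = -2 * f k" if "k \<le> n" for k
    using that by (simp add: p_def f_def Suc_diff_le)
  have "2 * a (Suc n) = 2 * (\<Sum>k<Suc (Suc n). g k)"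
    by (simp only: a_def g_def atLeast0AtMost lessThan_Suc_atMost)
  also have "\<dots> = 2 * g 0 + 2 * g 1 + (\<Sum>k<n. 2 * g (Suc (Suc k)))"
    by (simp add: sum.lessThan_Suc_shift sum_distrib_left del: sum.lessThan_Suc)
  also have "\<dots> = 2 * p 0 + 2 * p 1 + (\<Sum>k<n. 2 * p (Suc (Suc k)) - f k)"
    using pascal by (simp add: g_def p_def)
  also have "\<dots> = 2 * (\<Sum>k<Suc (Suc n). p k) - T"
    by (simp add: sum.lessThan_Suc_shift sum_distrib_left sum_subtractf T_def
        del: sum.lessThan_Suc)
  also have "(\<Sum>k<Suc (Suc n). p k) = (\<Sum>k<Suc n. p k) + M"
    using middle_binomial_round_up[of n] by (simp add: p_def M_def)
  also have "(\<Sum>k<Suc n. p k) = -2 * (\<Sum>k<Suc n. f k)"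
    unfolding sum_distrib_left by (rule sum.cong) (use p_f in auto)
  also have "(\<Sum>k<Suc n. f k) = a n"
    by (simp only: a_def f_def atLeast0AtMost lessThan_Suc_atMost)
  finally show ?thesis using a_n by (simp add: M_def)
qed

theorem theorem7p1:
  fixes n :: nat
  assumes "n \<ge> 3"
  shows "2 * int n * a n + (5 * int n - 4) * a (n - 1) - (8 * int n - 6) * a (n - 2)
           - 20 * (int n - 2) * a (n - 3) = 0"
proof -
  obtain m where n: "n = m + 3" using assms le_Suc_ex by (metis add.commute)
  define M where "M k = int (k choose (k div 2))" for k
  have d: "2 * a (k + 1) + 5 * a k = 3 * M k" for k
    using a_Suc[of k] by (simp add: M_def)
  have rec: "(int m + 3) * M (m + 2) = 2 * M (m + 1) + 4 * (int m + 1) * M m"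
    using arg_cong[OF middle_binomial_recurrence[of m], of int]
    by (simp only: M_def of_nat_add of_nat_mult of_nat_numeral of_nat_1)
  \<comment> \<open>The operator of order three factors: it is the one in \<open>rec\<close> applied to \<open>2 * a (k + 1) + 5 * a k\<close>.\<close>
  have "2 * int n * a n + (5 * int n - 4) * a (n - 1) - (8 * int n - 6) * a (n - 2)
          - 20 * (int n - 2) * a (n - 3)
      = (int m + 3) * (2 * a (m + 2 + 1) + 5 * a (m + 2))
          - 2 * (2 * a (m + 1 + 1) + 5 * a (m + 1))
          - 4 * (int m + 1) * (2 * a (m + 1) + 5 * a m)"
    by (simp add: n algebra_simps numeral_3_eq_3)
  also have "\<dots> = 3 * ((int m + 3) * M (m + 2) - 2 * M (m + 1) - 4 * (int m + 1) * M m)"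
    unfolding d by (simp add: algebra_simps)
  also have "\<dots> = 0" using rec by simp
  finally show ?thesis .
qed

end
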